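(* Let $a,b\in[0,\infty)$ with $a<b$, let $m\in(0,1]$, and let $f:[0,\infty)\to(0,\infty)$ be a function which is $m$-logarithmically convex on $\left[0,\frac{b}{m}\right]$. Then $$\frac{1}{b-a}\int_a^b f(x)\,dx\le \min\left\{L\left(f(a),\left[f\left(\tfrac{b}{m}\right)\right]^m\right),\ L\left(f(b),\left[f\left(\tfrac{a}{m}\right)\right]^m\right)\right\},$$ where $L$ denotes the logarithmic mean.
   Context: For fixed $m\in(0,1]$ and $c>0$, a positive function $f$ is $m$-logarithmically convex on $[0,c]$ if $f(tx+m(1-t)y)\le [f(x)]^{t}[f(y)]^{m(1-t)}$ for all $x,y\in[0,c]$ and all $t\in[0,1]$. The logarithmic mean of $p,q>0$ is $L(p,q)=\frac{p-q}{\ln p-\ln q}$ if $p\ne q$, and $L(p,p)=p$. *)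

theory Defs
  imports "HOL-Analysis.Analysis"
begin

definition m_log_convex :: "real \<Rightarrow> real \<Rightarrow> (real \<Rightarrow> real) \<Rightarrow> bool" where
  "m_log_convex m c f \<longleftrightarrow>
     (\<forall>x\<in>{0..c}. 0 < f x) \<and>
     (\<forall>x\<in>{0..c}. \<forall>y\<in>{0..c}. \<forall>t\<in>{0..1}.
        f (t * x + m * (1 - t) * y) \<le> f x powr t * f y powr (m * (1 - t)))"

definition log_mean :: "real \<Rightarrow> real \<Rightarrow> real" where
  "log_mean p q = (if p = q then p else (p - q) / (ln p - ln q))"

end

theory Submission
  imports Defs
begin

text \<open>
  The two bounds come from writing a point of \<open>[a, b]\<close> in two ways as an \<open>m\<close>-convex combination:
  \<open>t a + (1 - t) b = t a + m (1 - t) (b / m)\<close>, and likewise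
  \<open>t b + (1 - t) a = t b + m (1 - t) (a / m)\<close>. In each case \<open>f\<close> is majorised on \<open>[a, b]\<close> by a
  geometric interpolation \<open>p\<^sup>t q\<^sup>1\<^sup>-\<^sup>t\<close> of two constants, and the mean value of such an
  exponential function is exactly the logarithmic mean of its two end values.

  Integrability of \<open>f\<close> is part of the claim. An \<open>m\<close>-logarithmically convex function may jump, so
  continuity is not available. Comparing a point only with the origin suffices, however: with
  \<open>y = 0\<close>, the defining inequality says that \<open>x \<mapsto> ln (f x) - m ln (f 0)\<close> is star-shaped, that is,
  its quotient by \<open>x\<close> is nondecreasing. Monotone functions are Borel measurable, so \<open>f\<close>
  is measurable away from \<open>0\<close>; the same inequality bounds it, and a bounded
  measurable function on a bounded interval is integrable.
\<close>

lemma m_log_convex_pos: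
  assumes "m_log_convex m c f" "0 \<le> x" "x \<le> c"
  shows "0 < f x"
  using assms by (auto simp: m_log_convex_def)

lemma m_log_convexD:
  assumes "m_log_convex m c f" "0 \<le> x" "x \<le> c" "0 \<le> y" "y \<le> c" "0 \<le> t" "t \<le> 1"
  shows "f (t * x + m * (1 - t) * y) \<le> f x powr t * f y powr (m * (1 - t))"
  using assms by (auto simp: m_log_convex_def)

text \<open>
  Taking \<open>y = 0\<close> makes the \<open>m\<close>-convex combination collapse to \<open>t x\<close>, whatever \<open>m\<close> is. This yields
  monotonicity of slopes from the origin, with the value at the origin weighted by \<open>m\<close>; it is
  the source of measurability below.
\<close>

lemma m_log_convex_slope_mono:
  assumes "m_log_convex m c f"
  shows "mono_on {0<..c} (\<lambda>x. (ln (f x) - m * ln (f 0)) / x)"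
proof (rule mono_onI)
  fix x y assume xy: "x \<in> {0<..c}" "y \<in> {0<..c}" "x \<le> y"
  define t where "t = x / y"
  have t: "0 \<le> t" "t \<le> 1" "t * y = x" using xy by (auto simp: t_def)
  have pos: "0 < f x" "0 < f y" "0 < f 0" using xy m_log_convex_pos[OF assms] by auto
  have "f x \<le> f y powr t * f 0 powr (m * (1 - t))"
    using m_log_convexD[OF assms, of y 0 t] xy t by simp
  then have "ln (f x) \<le> ln (f y powr t * f 0 powr (m * (1 - t)))"
    using pos by (subst ln_le_cancel_iff) auto
  also have "\<dots> = t * ln (f y) + m * (1 - t) * ln (f 0)"
    using pos by (simp add: ln_mult ln_powr)
  finally have "ln (f x) - m * ln (f 0) \<le> t * (ln (f y) - m * ln (f 0))"
    by (simp add: algebra_simps)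
  then show "(ln (f x) - m * ln (f 0)) / x \<le> (ln (f y) - m * ln (f 0)) / y"
    using xy by (simp add: t_def field_simps)
qed

text \<open>
  The function is recovered from its monotone slope \<open>k\<close> as \<open>exp (x k(x) + m ln (f 0))\<close>. The
  origin is left out because the slope is meaningless there.
\<close>

lemma m_log_convex_measurable:
  assumes "m_log_convex m c f"
  shows "f \<in> borel_measurable (lebesgue_on {0<..c})"
proof -
  define k where "k = (\<lambda>x. (ln (f x) - m * ln (f 0)) / x)"
  have "k \<in> borel_measurable (restrict_space borel {0<..c})"
    unfolding k_def by (intro borel_measurable_mono_on_fnc m_log_convex_slope_mono assms)
  moreover have "(\<lambda>x. x) \<in> borel_measurable (restrict_space borel {0<..c})"
    by (intro measurable_restrict_space1) simp
  ultimately have "(\<lambda>x. exp (x * k x + m * ln (f 0))) \<in> borel_measurable (restrict_space borel {0<..c})"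
    by measurable
  also have "?this \<longleftrightarrow> f \<in> borel_measurable (restrict_space borel {0<..c})"
    using m_log_convex_pos[OF assms]
    by (intro measurable_cong) (auto simp: k_def space_restrict_space)
  finally have "(\<lambda>x. indicator {0<..c} x *\<^sub>R f x) \<in> borel_measurable borel"
    by (subst (asm) borel_measurable_restrict_space_iff) auto
  then have "(\<lambda>x. indicator {0<..c} x *\<^sub>R f x) \<in> borel_measurable lebesgue"
    by (intro measurable_completion) simp
  then show ?thesis
    by (subst borel_measurable_restrict_space_iff) auto
qed

lemma powr_le_max_one:
  assumes "0 < (p::real)" "0 \<le> s" "s \<le> 1"
  shows "p powr s \<le> max 1 p"
proof (cases "p \<le> 1")
  case True
  then show ?thesis using assms powr_mono2[of s p 1] by simp
next
  case False
  then show ?thesis using assms powr_mono[of s 1 p] by simp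
qed

text \<open>
  The same comparison with the origin, now with \<open>x\<close> on the segment from \<open>0\<close> to \<open>c\<close>, bounds \<open>f\<close>
  by powers of \<open>f c\<close> and \<open>f 0\<close> whose exponents lie in \<open>[0, 1]\<close>.
\<close>

lemma m_log_convex_bounded:
  assumes "m_log_convex m c f" "0 \<le> m" "m \<le> 1" "x \<in> {0<..c}"
  shows "f x \<le> max 1 (f c) * max 1 (f 0)"
proof -
  define t where "t = x / c"
  have t: "0 \<le> t" "t \<le> 1" "t * c = x" using assms by (auto simp: t_def)
  have pos: "0 < f c" "0 < f 0" using assms m_log_convex_pos[OF assms(1)] by auto
  have "f x \<le> f c powr t * f 0 powr (m * (1 - t))"
    using m_log_convexD[OF assms(1), of c 0 t] assms t by simp
  also have "\<dots> \<le> max 1 (f c) * max 1 (f 0)"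
    using t pos assms by (intro mult_mono powr_le_max_one) (auto intro: mult_le_one)
  finally show ?thesis .
qed

text \<open>
  Measurability and the bound hold on \<open>(0, c]\<close>; the missing origin is a null set.
\<close>

lemma m_log_convex_integrable:
  assumes "m_log_convex m c f" "0 \<le> m" "m \<le> 1" "0 \<le> a" "b \<le> c"
  shows "f integrable_on {a..b}"
proof -
  have "f integrable_on {0<..c}"
  proof (rule measurable_bounded_by_integrable_imp_integrable)
    show "f \<in> borel_measurable (lebesgue_on {0<..c})"
      using assms by (intro m_log_convex_measurable)
    show "(\<lambda>x. max 1 (f c) * max 1 (f 0)) integrable_on {0<..c}"
      by (intro integrable_on_const bounded_set_imp_lmeasurable) auto
    show "norm (f x) \<le> max 1 (f c) * max 1 (f 0)" if "x \<in> {0<..c}" for x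
      using m_log_convex_bounded[OF assms(1-3) that] m_log_convex_pos[OF assms(1), of x] that by auto
  qed simp
  then have "f integrable_on {0..c}"
    by (rule integrable_spike_set) (auto intro: negligible_subset[of "{0}"])
  then show ?thesis
    by (rule integrable_on_subinterval) (use assms in auto)
qed

lemma log_mean_commute: "log_mean p q = log_mean q p"
  using minus_divide_divide[of "p - q" "ln p - ln q"] by (simp add: log_mean_def)

text \<open>
  The integrand is the exponential of the affine function running from \<open>ln p\<close> at \<open>a\<close> to \<open>ln q\<close>
  at \<open>b\<close>, so for \<open>p \<noteq> q\<close> it is its own antiderivative up to the inverse of the slope; the
  difference of its end values over the difference of their logarithms is the logarithmic mean.
\<close>

lemma has_integral_geometric_interpolation:
  assumes "a < b" "0 < p" "0 < q"
  shows "((\<lambda>x. p powr ((b - x) / (b - a)) * q powr ((x - a) / (b - a)))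
           has_integral (b - a) * log_mean p q) {a..b}"
proof (cases "p = q")
  case True
  have "p powr ((b - x) / (b - a)) * p powr ((x - a) / (b - a)) = p" for x
    using assms by (simp add: powr_add[symmetric] add_divide_distrib[symmetric])
  then show ?thesis
    using True has_integral_const_real[of p a b] assms by (simp add: log_mean_def)
next
  case False
  define d where "d = ln q - ln p"
  have d: "d \<noteq> 0" using False assms by (simp add: d_def)
  define e where "e = (\<lambda>x. exp (((b - x) * ln p + (x - a) * ln q) / (b - a)))"
  have e: "p powr ((b - x) / (b - a)) * q powr ((x - a) / (b - a)) = e x" for x
    using assms by (simp add: e_def powr_def exp_add[symmetric] add_divide_distrib)
  have "(e has_integral (b - a) / d * e b - (b - a) / d * e a) {a..b}"
  proof (rule fundamental_theorem_of_calculus)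
    fix x
    have "(e has_real_derivative e x * (d / (b - a))) (at x within {a..b})"
      unfolding e_def d_def using assms by (auto intro!: derivative_eq_intros)
    from DERIV_cmult[OF this, of "(b - a) / d"]
    show "((\<lambda>x. (b - a) / d * e x) has_vector_derivative e x) (at x within {a..b})"
      using assms d by (simp add: has_real_derivative_iff_has_vector_derivative)
  qed (use assms in simp)
  moreover have "e a = p" "e b = q" using assms by (auto simp: e_def)
  moreover have "(b - a) / d * q - (b - a) / d * p = (b - a) * log_mean q p"
    using False by (simp add: log_mean_def d_def algebra_simps diff_divide_distrib)
  ultimately show ?thesis
    by (simp add: e log_mean_commute[of p q])
qed

lemma mean_le_log_mean:
  assumes "a < b" "0 < p" "0 < q" "f integrable_on {a..b}"
    and le: "\<And>t. 0 \<le> t \<Longrightarrow> t \<le> 1 \<Longrightarrow> f (t * a + (1 - t) * b) \<le> p powr t * q powr (1 - t)"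
  shows "1 / (b - a) * integral {a..b} f \<le> log_mean p q"
proof -
  have "integral {a..b} f \<le> (b - a) * log_mean p q"
  proof (rule has_integral_le[OF integrable_integral[OF assms(4)]
        has_integral_geometric_interpolation[OF assms(1-3)]])
    fix x assume x: "x \<in> {a..b}"
    define t where "t = (b - x) / (b - a)"
    have t: "0 \<le> t" "t \<le> 1" "1 - t = (x - a) / (b - a)"
      using x assms(1) by (auto simp: t_def field_simps)
    have "t * (b - a) = b - x" using assms(1) by (simp add: t_def)
    then have "t * a + (1 - t) * b = x" by (simp add: algebra_simps)
    then show "f x \<le> p powr ((b - x) / (b - a)) * q powr ((x - a) / (b - a))"
      using le[OF t(1,2)] unfolding t(3) by (simp add: t_def)
  qed
  then show ?thesis using assms(1) by (simp add: field_simps)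
qed

theorem theorem3:
  fixes a b m :: real and f :: "real \<Rightarrow> real"
  assumes "0 \<le> a" and "a < b"
    and "0 < m" and "m \<le> 1"
    and "\<And>x. 0 \<le> x \<Longrightarrow> 0 < f x"
    and "m_log_convex m (b / m) f"
  shows "f integrable_on {a..b} \<and>
    1 / (b - a) * integral {a..b} f
      \<le> min (log_mean (f a) (f (b / m) powr m)) (log_mean (f b) (f (a / m) powr m))"
proof -
  have b: "b \<le> b / m" using assms(1-4) by (simp add: pos_le_divide_eq mult_left_le)
  have am: "0 \<le> a / m" "a / m \<le> b / m" using assms(1-4) by (auto simp: divide_right_mono)
  have int: "f integrable_on {a..b}"
    using m_log_convex_integrable[OF assms(6)] assms(1-4) b by simp
  have pos: "0 < f a" "0 < f b" "0 < f (a / m)" "0 < f (b / m)"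
    using assms(1-3) am by (auto intro!: assms(5))
  \<comment> \<open>Represent the right end as \<open>m (b / m)\<close> and then the left end as \<open>m (a / m)\<close>; these
    scaled points stay in the domain of convexity.\<close>
  have "1 / (b - a) * integral {a..b} f \<le> log_mean (f a) (f (b / m) powr m)"
  proof (rule mean_le_log_mean)
    fix t :: real assume "0 \<le> t" "t \<le> 1"
    then show "f (t * a + (1 - t) * b) \<le> f a powr t * (f (b / m) powr m) powr (1 - t)"
      using m_log_convexD[OF assms(6), of a "b / m" t] assms(1-3) b by (simp add: powr_powr)
  qed (use assms(2) pos int in auto)
  moreover have "1 / (b - a) * integral {a..b} f \<le> log_mean (f (a / m) powr m) (f b)"
  proof (rule mean_le_log_mean)
    fix t :: real assume "0 \<le> t" "t \<le> 1"
    then show "f (t * a + (1 - t) * b) \<le> (f (a / m) powr m) powr t * f b powr (1 - t)"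
      using m_log_convexD[OF assms(6), of b "a / m" "1 - t"] assms(1-3) b am
      by (simp add: powr_powr add.commute mult.commute)
  qed (use assms(2) pos int in auto)
  ultimately show ?thesis
    using int by (simp add: log_mean_commute[of "f b"])
qed

end
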